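(* Fix $n\in\mathbb{Z}_{\geq0}$. All closed points in $\mathcal{P}(\mathrm{Mon}_n)$ are orders if and only if $n\leq2$.
   Context: $\mathrm{Mon}_n=\{x^\alpha\mid\alpha\in\mathbb{Z}_{\geq0}^n\}$ is the commutative monoid of monomials in $n$ variables. A preorder on a commutative monoid $\Pi$ is a binary relation $\leq$ on $\Pi$ that is reflexive, transitive, and total, and satisfies $v\leq w\Rightarrow uv\leq uw$ for all $u,v,w\in\Pi$; it is an order if it is also anti-symmetric. Write $u<v$ if $u\leq v$ but not $v\leq u$. $\mathcal{P}(\Pi)$ is the set of all preorders on $\Pi$ with the coarsest topology in which, for all $u,v\in\Pi$, the set $\{{\leq}\mid u<v\}$ is closed. A closed point is a preorder $\leq$ such that $\{\leq\}$ is closed in $\mathcal{P}(\Pi)$. *)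

theory Defs
  imports "HOL-Algebra.Group" "HOL-Analysis.Abstract_Topology"
begin

text \<open>A binary relation on the underlying set of a monoid is represented by its graph, with
  \<open>(u, v) \<in> r\<close> standing for \<open>u \<le> v\<close>. The condition \<open>r \<subseteq> carrier \<times> carrier\<close>, which makes the graph
  determine the relation and conversely, is part of \<^const>\<open>preorder_on\<close>.\<close>

definition monoid_preorder :: "('a, 'b) monoid_scheme \<Rightarrow> 'a rel \<Rightarrow> bool" where
  "monoid_preorder G r \<longleftrightarrow>
     preorder_on (carrier G) r \<and> total_on (carrier G) r \<and>
     (\<forall>u \<in> carrier G. \<forall>v \<in> carrier G. \<forall>w \<in> carrier G.
        (v, w) \<in> r \<longrightarrow> (u \<otimes>\<^bsub>G\<^esub> v, u \<otimes>\<^bsub>G\<^esub> w) \<in> r)"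

definition monoid_order :: "('a, 'b) monoid_scheme \<Rightarrow> 'a rel \<Rightarrow> bool" where
  "monoid_order G r \<longleftrightarrow> monoid_preorder G r \<and> antisym r"

definition strictly_below :: "'a rel \<Rightarrow> 'a \<Rightarrow> 'a \<Rightarrow> bool" where
  "strictly_below r u v \<longleftrightarrow> (u, v) \<in> r \<and> (v, u) \<notin> r"

definition preorder_topology :: "('a, 'b) monoid_scheme \<Rightarrow> 'a rel topology" where
  "preorder_topology G = topology_generated_by
     {{r. monoid_preorder G r} - {r. monoid_preorder G r \<and> strictly_below r u v} | u v.
        u \<in> carrier G \<and> v \<in> carrier G}"

text \<open>No preorder satisfies \<open>u < u\<close>, so the subbasis covers the set of all preorders as soon as the
  carrier is non-empty.\<close>

lemma topspace_preorder_topology: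
  assumes "comm_monoid G"
  shows "topspace (preorder_topology G) = {r. monoid_preorder G r}"
proof -
  interpret comm_monoid G by (rule assms)
  let ?P = "{r. monoid_preorder G r}"
  let ?S = "{?P - {r. monoid_preorder G r \<and> strictly_below r u v} | u v.
        u \<in> carrier G \<and> v \<in> carrier G}"
  have "?P - {r. monoid_preorder G r \<and> strictly_below r \<one>\<^bsub>G\<^esub> \<one>\<^bsub>G\<^esub>} = ?P"
    by (auto simp: strictly_below_def)
  then have "?P \<in> ?S"
    using one_closed by blast
  then have "\<Union>?S = ?P"
    by blast
  then show ?thesis
    unfolding preorder_topology_def topology_generated_by_topspace .
qed

definition closed_point :: "('a, 'b) monoid_scheme \<Rightarrow> 'a rel \<Rightarrow> bool" where
  "closed_point G r \<longleftrightarrow> monoid_preorder G r \<and> closedin (preorder_topology G) {r}"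

text \<open>The monomial \<open>x\<^sup>\<alpha>\<close> in the variables \<open>x\<^sub>0, \<dots>, x\<^sub>n\<^sub>-\<^sub>1\<close> is represented by its exponent vector
  \<open>\<alpha>\<close>, a function vanishing at all indices \<open>i \<ge> n\<close>; the case \<open>n = 0\<close> gives the trivial monoid.\<close>

definition Mon :: "nat \<Rightarrow> (nat \<Rightarrow> nat) monoid" where
  "Mon n = \<lparr>carrier = {\<alpha>. \<forall>i \<ge> n. \<alpha> i = 0}, mult = (\<lambda>\<alpha> \<beta> i. \<alpha> i + \<beta> i), one = (\<lambda>i. 0)\<rparr>"

lemma comm_monoid_Mon: "comm_monoid (Mon n)"
  by (rule comm_monoidI) (auto simp: Mon_def add.assoc add.commute)

end

theory Submission
  imports Defs
begin

text \<open>Since \<open>\<not> u < v\<close> means \<open>v \<le> u\<close> for a total relation, the closed points are exactly the preorders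
  whose graphs are minimal for inclusion, and by Zorn's lemma there is one inside every preorder. An
  order on \<open>Mon n\<close> is cancellative, so it has no cycle \<open>u\<^sub>i < v\<^sub>i\<close> with \<open>\<Prod>u\<^sub>i = \<Prod>v\<^sub>i\<close>.

  For \<open>n \<ge> 3\<close>, give \<open>x, y, z\<close> the weights \<open>3, 4, 5\<close>, identify all monomials of weight at least \<open>11\<close>,
  and break the ties in the weights \<open>8, 9, 10\<close> by \<open>y\<^sup>2 < xz\<close>, \<open>x\<^sup>3 < yz\<close>, \<open>z\<^sup>2 < x\<^sup>2y\<close>. The two sides
  of these have the same product, so no order is contained in this preorder.

  For \<open>n \<le> 2\<close>, whether \<open>u \<le> u + (s, t)\<close> is forced depends only on the sign of \<open>(s, t)\<close>, that is, on
  the comparison of its negative with its positive part. In the quadrant where the signs vary, a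
  subtractive Euclidean descent shows that the strictly positive vectors have larger slope than the
  strictly negative ones, so a line through the origin separates them.\<close>

section \<open>Closed points are minimal preorders\<close>

lemma monoid_preorder_total:
  "monoid_preorder G r \<Longrightarrow> u \<in> carrier G \<Longrightarrow> v \<in> carrier G \<Longrightarrow> (u, v) \<in> r \<or> (v, u) \<in> r"
  by (cases "u = v") (auto simp: monoid_preorder_def total_on_def preorder_on_def refl_on_def)

lemma monoid_preorder_trans:
  "monoid_preorder G r \<Longrightarrow> (u, v) \<in> r \<Longrightarrow> (v, w) \<in> r \<Longrightarrow> (u, w) \<in> r"
  by (auto simp: monoid_preorder_def preorder_on_def dest: transD)

lemma monoid_preorder_carrier:
  "monoid_preorder G r \<Longrightarrow> (u, v) \<in> r \<Longrightarrow> u \<in> carrier G \<and> v \<in> carrier G"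
  by (auto simp: monoid_preorder_def preorder_on_def)

lemma monoid_preorder_mult:
  "monoid_preorder G r \<Longrightarrow> w \<in> carrier G \<Longrightarrow> (u, v) \<in> r \<Longrightarrow> (w \<otimes>\<^bsub>G\<^esub> u, w \<otimes>\<^bsub>G\<^esub> v) \<in> r"
  using monoid_preorder_carrier[of G r u v] by (simp add: monoid_preorder_def)

lemma monoid_preorderI:
  assumes "r \<subseteq> carrier G \<times> carrier G"
    and "\<And>u v. u \<in> carrier G \<Longrightarrow> v \<in> carrier G \<Longrightarrow> (u, v) \<in> r \<or> (v, u) \<in> r"
    and "\<And>u v w. (u, v) \<in> r \<Longrightarrow> (v, w) \<in> r \<Longrightarrow> (u, w) \<in> r"
    and "\<And>u v w. w \<in> carrier G \<Longrightarrow> (u, v) \<in> r \<Longrightarrow> (w \<otimes>\<^bsub>G\<^esub> u, w \<otimes>\<^bsub>G\<^esub> v) \<in> r"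
  shows "monoid_preorder G r"
proof -
  have "trans r"
    using assms(3) by (rule transI)
  moreover have "refl_on (carrier G) r" "total_on (carrier G) r"
    using assms(2) unfolding refl_on_def total_on_def by blast+
  ultimately show ?thesis
    using assms(1,4) by (simp add: monoid_preorder_def preorder_on_def)
qed

text \<open>By totality a subbasic open set consists of the preorders containing
  \<open>(v, u)\<close>, so enlarging the graph does not leave it; finite intersections and unions
  inherit this.\<close>

lemma open_contains_superset:
  assumes "openin (preorder_topology G) U" "s \<in> U" "s \<subseteq> r" "monoid_preorder G r"
  shows "r \<in> U"
proof -
  have "generate_topology_on
     {{r. monoid_preorder G r} - {r. monoid_preorder G r \<and> strictly_below r u v} | u v.
        u \<in> carrier G \<and> v \<in> carrier G} U"
    using assms(1) unfolding preorder_topology_def by (simp add: openin_topology_generated_by_iff)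
  then show ?thesis
    using assms(2)
  proof induction
    case (Basis X)
    then obtain u v where X: "u \<in> carrier G" "v \<in> carrier G"
      "X = {r. monoid_preorder G r} - {r. monoid_preorder G r \<and> strictly_below r u v}"
      by blast
    with Basis have "monoid_preorder G s" "\<not> strictly_below s u v"
      by auto
    then have "(v, u) \<in> s"
      using monoid_preorder_total X unfolding strictly_below_def by metis
    then show ?case
      using assms X unfolding strictly_below_def by blast
  qed auto
qed

lemma closed_point_iff_minimal:
  assumes "comm_monoid G"
  shows "closed_point G r \<longleftrightarrow>
    monoid_preorder G r \<and> (\<forall>s. monoid_preorder G s \<and> s \<subseteq> r \<longrightarrow> s = r)"
proof (intro iffI conjI allI impI)
  assume cl: "closed_point G r"
  then show r: "monoid_preorder G r"
    by (simp add: closed_point_def)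
  fix s assume s: "monoid_preorder G s \<and> s \<subseteq> r"
  show "s = r"
  proof (rule ccontr)
    assume "s \<noteq> r"
    then have "s \<in> topspace (preorder_topology G) - {r}"
      using s topspace_preorder_topology[OF assms] by auto
    moreover have "openin (preorder_topology G) (topspace (preorder_topology G) - {r})"
      using cl by (simp add: closed_point_def closedin_def)
    ultimately have "r \<in> topspace (preorder_topology G) - {r}"
      using open_contains_superset s r by blast
    then show False by simp
  qed
next
  assume r: "monoid_preorder G r \<and> (\<forall>s. monoid_preorder G s \<and> s \<subseteq> r \<longrightarrow> s = r)"
  let ?P = "{r. monoid_preorder G r}"
  let ?N = "\<lambda>u v. ?P - {r. monoid_preorder G r \<and> strictly_below r u v}"
  have "\<exists>U. openin (preorder_topology G) U \<and> s \<in> U \<and> U \<subseteq> ?P - {r}"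
    if "s \<in> ?P - {r}" for s
  proof -
    \<comment> \<open>By minimality of \<open>r\<close>. The preorders containing a pair of
      \<open>s\<close> outside \<open>r\<close> form an open neighbourhood of \<open>s\<close> that
      misses \<open>r\<close>.\<close>
    have "\<not> s \<subseteq> r" using r that by auto
    then obtain u v where uv: "(u, v) \<in> s" "(u, v) \<notin> r"
      by auto
    have s: "monoid_preorder G s" using that by simp
    have c: "u \<in> carrier G" "v \<in> carrier G"
      using monoid_preorder_carrier[OF s uv(1)] by auto
    then have "(v, u) \<in> r"
      using monoid_preorder_total[OF conjunct1[OF r]] uv(2) by blast
    then have "s \<in> ?N v u" "?N v u \<subseteq> ?P - {r}"
      using that uv r by (auto simp: strictly_below_def)
    moreover have "openin (preorder_topology G) (?N v u)"
      unfolding preorder_topology_def by (rule topology_generated_by_Basis) (use c in auto)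
    ultimately show ?thesis by blast
  qed
  then have "openin (preorder_topology G) (?P - {r})"
    by (subst openin_subopen) blast
  then show "closed_point G r"
    using r by (simp add: closed_point_def closedin_def topspace_preorder_topology[OF assms])
qed

section \<open>Minimal preorders by Zorn's lemma\<close>

lemma minimal_preorder_exists:
  assumes r: "monoid_preorder G r"
  obtains m where "monoid_preorder G m" "m \<subseteq> r"
    "\<And>s. monoid_preorder G s \<Longrightarrow> s \<subseteq> m \<Longrightarrow> s = m"
proof -
  \<comment> \<open>Complements turn minimal preorders into maximal sets; the union of a chain of
    them is the complement of the intersection of the preorders.\<close>
  let ?A = "{X. monoid_preorder G (- X) \<and> - X \<subseteq> r}"
  have "\<exists>U\<in>?A. \<forall>X\<in>K. X \<subseteq> U" if K: "subset.chain ?A K" for K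
  proof (cases "K = {}")
    case True
    then show ?thesis using r by (intro bexI[of _ "- r"]) auto
  next
    case False
    have sub: "\<And>X. X \<in> K \<Longrightarrow> monoid_preorder G (- X) \<and> - X \<subseteq> r"
      using K unfolding subset.chain_def by blast
    have lin: "\<And>X Y. X \<in> K \<Longrightarrow> Y \<in> K \<Longrightarrow> X \<subseteq> Y \<or> Y \<subseteq> X"
      using K unfolding subset_chain_def by blast
    have "monoid_preorder G (- \<Union>K)"
    proof (rule monoid_preorderI)
      show "- \<Union>K \<subseteq> carrier G \<times> carrier G"
        using False sub monoid_preorder_carrier by fastforce
    next
      fix u v assume "u \<in> carrier G" "v \<in> carrier G"
      then have *: "(u, v) \<notin> X \<or> (v, u) \<notin> X" if "X \<in> K" for X
        using sub[OF that] monoid_preorder_total by fastforce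
      show "(u, v) \<in> - \<Union>K \<or> (v, u) \<in> - \<Union>K"
      proof (rule ccontr)
        assume "\<not> ?thesis"
        \<comment> \<open>The larger of \<open>X\<close> and \<open>Y\<close> contains both pairs,
          so its complement would not be total.\<close>
        then obtain X Y where XY: "X \<in> K" "(u, v) \<in> X" "Y \<in> K" "(v, u) \<in> Y"
          by blast
        then show False
          using lin[of X Y] *[of X] *[of Y] by blast
      qed
    next
      fix u v w assume "(u, v) \<in> - \<Union>K" "(v, w) \<in> - \<Union>K"
      then show "(u, w) \<in> - \<Union>K"
        using sub monoid_preorder_trans by fastforce
    next
      fix u v w assume "w \<in> carrier G" "(u, v) \<in> - \<Union>K"
      then show "(w \<otimes>\<^bsub>G\<^esub> u, w \<otimes>\<^bsub>G\<^esub> v) \<in> - \<Union>K"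
        using sub monoid_preorder_mult by fastforce
    qed
    moreover have "- \<Union>K \<subseteq> r"
      using False sub by blast
    ultimately show ?thesis by blast
  qed
  from subset_Zorn[OF this] obtain M where M: "M \<in> ?A" "\<forall>X\<in>?A. M \<subseteq> X \<longrightarrow> X = M"
    by blast
  show thesis
  proof (rule that[of "- M"])
    fix s assume "monoid_preorder G s" "s \<subseteq> - M"
    then have "- s \<in> ?A" "M \<subseteq> - s" using M(1) by auto
    then have "- s = M" using M(2) by blast
    then show "s = - M" by auto
  qed (use M(1) in auto)
qed

section \<open>Orders inside preorders in two variables\<close>

text \<open>\<open>C s t\<close> stands for nonnegativity of \<open>(s, t)\<close>. Nonnegativity is only known to be additive when no
  coordinate cancels, except that a coordinate may be shortened by a nonnegative axis vector.\<close>

locale sign_cone =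
  fixes C :: "int \<Rightarrow> int \<Rightarrow> bool"
  assumes total: "C s t \<or> C (- s) (- t)"
    and add: "C s t \<Longrightarrow> C s' t' \<Longrightarrow> 0 \<le> s * s' \<Longrightarrow> 0 \<le> t * t' \<Longrightarrow> C (s + s') (t + t')"
    and shorten: "C s t \<Longrightarrow> C 0 k \<Longrightarrow> k * t \<le> 0 \<Longrightarrow> \<bar>k\<bar> \<le> \<bar>t\<bar> \<Longrightarrow> C s (t + k)"
begin

lemma zero: "C 0 0"
  using total[of 0 0] by simp

lemma multiple: "C s t \<Longrightarrow> C (int k * s) (int k * t)"
proof (induction k)
  case (Suc k)
  then have "C (s + int k * s) (t + int k * t)"
    by (intro add) (auto simp: mult.left_commute[of _ "int k"])
  then show ?case by (simp add: algebra_simps)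
qed (simp add: zero)

end

text \<open>The quadrant in which the sign is undetermined is the one of the vectors \<open>(s, t)\<close> with \<open>s\<close> and
  \<open>t\<close> of the same sign.\<close>

locale oriented_sign_cone = sign_cone +
  assumes pos_axis: "C 1 0" and neg_axis: "C 0 (- 1)"
begin

lemma axes: "C (int k) 0" "C 0 (- int k)"
  using multiple[OF pos_axis, of k] multiple[OF neg_axis, of k] by simp_all

text \<open>Here \<open>(s, t)\<close> is strictly positive and \<open>(s', t')\<close> strictly
  negative. In a counterexample either the axes lead from the first to the second, or the smaller
  vector can be subtracted from the larger one, which leaves a smaller counterexample.\<close>

lemma slopes_separated:
  fixes s t s' t' :: nat
  assumes "\<not> C (- int s) (- int t)" "\<not> C (int s') (int t')"
  shows "s' * t < s * t'"
  using assms
proof (induction "s + t + s' + t'" arbitrary: s t s' t' rule: less_induct)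
  case less
  have p: "C (int s) (int t)" and p': "C (- int s') (- int t')"
    using total less.prems by (metis minus_minus)+
  have "s > 0" "t' > 0"
    using less.prems axes by (metis gr0I of_nat_0 minus_zero)+
  show ?case
  proof (rule ccontr)
    assume "\<not> s' * t < s * t'"
    then have le: "s * t' \<le> s' * t" by simp
    with \<open>s > 0\<close> \<open>t' > 0\<close> have "s' > 0" "t > 0"
      by (metis gr0I le_zero_eq mult_is_0 not_gr0)+
    consider "s \<le> s'" "t' \<le> t" | "s' < s" | "t < t'" by linarith
    then show False
    proof cases
      case 1
      \<comment> \<open>First \<open>s\<close> grows along the positive axis, then \<open>t\<close>
        shrinks along the negative one, where a coordinate cancels.\<close>
      have "C (int s + int (s' - s)) (int t + 0)"
        by (rule add[OF p axes(1)]) auto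
      then have "C (int s') (int t + - int (t - t'))"
        by (intro shorten axes) (use 1 in \<open>auto simp: of_nat_diff mult_le_0_iff\<close>)
      then show False using 1 less.prems by (simp add: of_nat_diff)
    next
      case 2
      have "s' * t' < s * t'" using 2 \<open>t' > 0\<close> by simp
      also note le
      finally have lt: "t' < t" by simp
      \<comment> \<open>The difference stays strictly positive: otherwise adding the negative of
        \<open>(s', t')\<close> would make the negative of \<open>(s, t)\<close>
        nonnegative.\<close>
      have "\<not> C (- int (s - s')) (- int (t - t'))"
      proof
        assume "C (- int (s - s')) (- int (t - t'))"
        then have "C (- int (s - s') + - int s') (- int (t - t') + - int t')"
          by (rule add[OF _ p']) (simp_all add: zero_le_mult_iff)
        then show False
          using 2 lt less.prems by (auto simp: of_nat_diff)
      qed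
      moreover have "s - s' + (t - t') + s' + t' < s + t + s' + t'"
        using \<open>s' > 0\<close> 2 lt by linarith
      ultimately have "s' * (t - t') < (s - s') * t'"
        using less.hyps less.prems by blast
      then show False
        using le 2 lt by (simp add: diff_mult_distrib diff_mult_distrib2)
    next
      case 3
      have "s * t' \<le> s' * t" by (rule le)
      also have "\<dots> < s' * t'" using 3 \<open>s' > 0\<close> by simp
      finally have lt: "s < s'" by simp
      have "\<not> C (int (s' - s)) (int (t' - t))"
      proof
        assume "C (int (s' - s)) (int (t' - t))"
        then have "C (int (s' - s) + int s) (int (t' - t) + int t)"
          by (rule add[OF _ p]) simp_all
        then show False
          using 3 lt less.prems by (auto simp: of_nat_diff)
      qed
      moreover have "s + t + (s' - s) + (t' - t) < s + t + s' + t'"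
        using \<open>s > 0\<close> 3 lt by linarith
      ultimately have "(s' - s) * t < s * (t' - t)"
        using less.hyps less.prems by blast
      then show False
        using le 3 lt by (simp add: diff_mult_distrib diff_mult_distrib2)
    qed
  qed
qed

text \<open>The first form vanishes on the line through the origin whose slope is the infimum over
  the strictly positive vectors of the quadrant and \<open>(1, 0)\<close>; the second settles the
  signs on that line.\<close>

lemma lex_weights:
  obtains \<alpha> \<beta> \<gamma> \<delta> :: real where "\<alpha> * \<delta> - \<beta> * \<gamma> \<noteq> 0"
    "\<And>s t. \<not> C (- s) (- t) \<Longrightarrow>
      \<alpha> * s + \<beta> * t > 0 \<or> (\<alpha> * s + \<beta> * t = 0 \<and> \<gamma> * s + \<delta> * t > 0)"
proof -
  \<comment> \<open>Adding \<open>(1, 0)\<close> makes the set nonempty, and the denominator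
    \<open>s + t\<close> gives it the largest slope, 1.\<close>
  define Q where "Q = insert (1, 0) {(s, t) | s t :: nat. \<not> C (- int s) (- int t)}"
  define slope where "slope = (\<lambda>(s, t). real s / (real s + real t))"
  define m where "m = Inf (slope ` Q)"
  \<comment> \<open>A vector of \<open>Q\<close> on the line means that the infimum is attained. A
    strictly negative one means that it is not, having smaller slope than all of \<open>Q\<close>.
    So one sign serves the whole line.\<close>
  define \<epsilon> :: real where "\<epsilon> = (if m \<in> slope ` Q then 1 else - 1)"
  have Qpos: "s > 0" if "(s, t) \<in> Q" for s t
    using that axes(2)[of t] by (cases "s = 0") (auto simp: Q_def)
  have Q_sep: "s' * t < s * t'" if "(s, t) \<in> Q" "\<not> C (int s') (int t')" for s t s' t' :: nat
  proof (cases "(s, t) = (1, 0)")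
    case True
    then show ?thesis using that axes(1)[of s'] by (cases "t' = 0") auto
  next
    case False
    then show ?thesis using that slopes_separated by (auto simp: Q_def)
  qed
  have bdd: "bdd_below (slope ` Q)"
    by (rule bdd_belowI[of _ 0]) (auto simp: slope_def)
  have ne: "(1, 0) \<in> Q" by (simp add: Q_def)
  have m_le: "m \<le> slope q" if "q \<in> Q" for q
    unfolding m_def using bdd that by (intro cInf_lower) auto
  have m1: "m \<le> 1" using m_le[OF ne] by (simp add: slope_def)
  have m0: "0 \<le> m" unfolding m_def
    using ne by (intro cInf_greatest) (auto simp: slope_def)
  have positive: "(1 - m) * s - m * t > 0 \<or>
      ((1 - m) * s - m * t = 0 \<and> \<epsilon> * s + \<epsilon> * t > 0)"
    if "(s, t) \<in> Q" for s t :: nat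
  proof -
    have st: "real s + real t > 0" using Qpos[OF that] by linarith
    have "m * (real s + real t) \<le> real s"
      using m_le[OF that] st by (simp add: slope_def field_simps)
    then have "(1 - m) * s - m * t \<ge> 0" by (simp add: algebra_simps)
    moreover have "\<epsilon> = 1" if "(1 - m) * s - m * t = 0"
    proof -
      have "m = slope (s, t)" using that st by (simp add: slope_def field_simps)
      then show ?thesis using \<open>(s, t) \<in> Q\<close> by (auto simp: \<epsilon>_def)
    qed
    ultimately show ?thesis using st by auto
  qed
  have negative: "(1 - m) * s - m * t < 0 \<or>
      ((1 - m) * s - m * t = 0 \<and> \<epsilon> * s + \<epsilon> * t < 0)"
    if C: "\<not> C (int s) (int t)" for s t :: nat
  proof -
    have "s \<noteq> 0 \<or> t \<noteq> 0" using C zero by (metis of_nat_0)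
    then have st: "real s + real t > 0" by linarith
    have less: "slope (s, t) < slope q" if "q \<in> Q" for q
    proof (cases q)
      case (Pair a b)
      then have ab: "real a + real b > 0" using Qpos that by fastforce
      have "s * b < a * t" using Q_sep C that Pair by blast
      then have "real s * real b < real a * real t"
        by (metis of_nat_less_iff of_nat_mult)
      then show ?thesis using ab st Pair by (simp add: slope_def field_simps)
    qed
    have "slope (s, t) \<le> m"
      unfolding m_def using ne less by (intro cInf_greatest) (auto intro: less_imp_le)
    then have "real s \<le> m * (real s + real t)"
      using st by (simp add: slope_def field_simps)
    then have "(1 - m) * s - m * t \<le> 0" by (simp add: algebra_simps)
    moreover have "\<epsilon> = - 1" if "(1 - m) * s - m * t = 0"
    proof -
      have "m = slope (s, t)" using that st by (simp add: slope_def field_simps)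
      then have "m \<notin> slope ` Q" using less by (metis imageE less_irrefl)
      then show ?thesis by (simp add: \<epsilon>_def)
    qed
    ultimately show ?thesis using st by auto
  qed
  show thesis
  proof (rule that[of "1 - m" \<epsilon> "- m" \<epsilon>])
    show "(1 - m) * \<epsilon> - - m * \<epsilon> \<noteq> 0" by (simp add: \<epsilon>_def)
  next
    fix s t :: int assume C: "\<not> C (- s) (- t)"
    have "(1 - m) * s - m * t > 0 \<or>
      ((1 - m) * s - m * t = 0 \<and> \<epsilon> * s + \<epsilon> * t > 0)"
    proof -
      \<comment> \<open>The axes decide the last two cases: in the third the first form is positive
        because \<open>m\<close> lies in [0, 1]; in the fourth the negative of \<open>(s, t)\<close>
        is nonnegative, contrary to the hypothesis.\<close>
      consider "s \<ge> 0" "t \<ge> 0" | "s \<le> 0" "t \<le> 0" | "s > 0" "t < 0" | "s < 0" "t > 0"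
        by linarith
      then show ?thesis
      proof cases
        case 1
        then have "(nat s, nat t) \<in> Q" using C by (simp add: Q_def)
        from positive[OF this] show ?thesis using 1 by simp
      next
        case 2
        then have "\<not> C (int (nat (- s))) (int (nat (- t)))" using C by simp
        from negative[OF this] show ?thesis using 2 by (auto simp: algebra_simps)
      next
        case 3
        have "(1 - m) * s \<ge> 0" "m * (- t) \<ge> 0" using 3 m0 m1 by (auto simp: mult_le_0_iff)
        moreover have "(1 - m) * s > 0 \<or> m * (- t) > 0"
          using 3 m0 m1 by (cases "m = 0") (auto simp: zero_less_mult_iff mult_less_0_iff)
        ultimately show ?thesis by auto
      next
        case 4
        have "C (int (nat (- s)) + 0) (0 + - int (nat t))"
          by (rule add[OF axes]) auto
        then show ?thesis using C 4 by simp
      qed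
    qed
    then show "(1 - m) * s + - m * t > 0 \<or>
        ((1 - m) * s + - m * t = 0 \<and> \<epsilon> * s + \<epsilon> * t > 0)"
      by simp
  qed
qed

end

text \<open>Reflecting the axes by signs \<open>a\<close> and \<open>b\<close> reduces to the
  oriented case; the determinant only changes by the factor \<open>a * b\<close>.\<close>

lemma (in sign_cone) lex_weights:
  obtains \<alpha> \<beta> \<gamma> \<delta> :: real where "\<alpha> * \<delta> - \<beta> * \<gamma> \<noteq> 0"
    "\<And>s t. \<not> C (- s) (- t) \<Longrightarrow>
      \<alpha> * s + \<beta> * t > 0 \<or> (\<alpha> * s + \<beta> * t = 0 \<and> \<gamma> * s + \<delta> * t > 0)"
proof -
  obtain a :: int where a: "C a 0" "a = 1 \<or> a = - 1"
    using total[of 1 0] by auto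
  obtain b :: int where b: "C 0 (- b)" "b = 1 \<or> b = - 1"
    using total[of 0 1] by (metis minus_minus minus_zero)
  have sq: "a * a = 1" "b * b = 1" using a b by auto
  have ab: "a * x * (a * y) = x * y" "b * x * (b * y) = x * y" for x y
    using a b by auto
  have abs: "\<bar>b * x\<bar> = \<bar>x\<bar>" for x using b by auto
  interpret O: oriented_sign_cone "\<lambda>s t. C (a * s) (b * t)"
  proof unfold_locales
    show "C (a * s) (b * t) \<or> C (a * - s) (b * - t)" for s t
      using total[of "a * s" "b * t"] by simp
    show "C (a * (s + s')) (b * (t + t'))"
      if "C (a * s) (b * t)" "C (a * s') (b * t')" "0 \<le> s * s'" "0 \<le> t * t'" for s t s' t'
      using add[OF that(1,2)] that(3,4) by (simp add: ab distrib_left)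
    show "C (a * s) (b * (t + k))"
      if "C (a * s) (b * t)" "C (a * 0) (b * k)" "k * t \<le> 0" "\<bar>k\<bar> \<le> \<bar>t\<bar>" for s t k
      using shorten[OF that(1), of "b * k"] that(2-4) by (simp add: ab abs distrib_left)
    show "C (a * 1) (b * 0)" "C (a * 0) (b * - 1)"
      using a b by simp_all
  qed
  obtain \<alpha> \<beta> \<gamma> \<delta> :: real where det: "\<alpha> * \<delta> - \<beta> * \<gamma> \<noteq> 0"
    and pos: "\<And>s t. \<not> C (a * - s) (b * - t) \<Longrightarrow>
      \<alpha> * s + \<beta> * t > 0 \<or> (\<alpha> * s + \<beta> * t = 0 \<and> \<gamma> * s + \<delta> * t > 0)"
    by (rule O.lex_weights) (rule that)
  show thesis
  proof (rule that[of "\<alpha> * a" "\<delta> * b" "\<beta> * b" "\<gamma> * a"])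
    have "\<alpha> * a * (\<delta> * b) - \<beta> * b * (\<gamma> * a) = (\<alpha> * \<delta> - \<beta> * \<gamma>) * (a * b)"
      by (simp add: algebra_simps)
    moreover have "real_of_int a * real_of_int b \<noteq> 0" using a b by auto
    ultimately show "\<alpha> * a * (\<delta> * b) - \<beta> * b * (\<gamma> * a) \<noteq> 0" using det by simp
  next
    fix s t assume C: "\<not> C (- s) (- t)"
    have "a * - (a * s) = - s" "b * - (b * t) = - t"
      using sq by (simp_all flip: mult.assoc)
    then have "\<not> C (a * - (a * s)) (b * - (b * t))" using C by metis
    from pos[OF this] show "\<alpha> * a * s + \<beta> * b * t > 0 \<or>
        (\<alpha> * a * s + \<beta> * b * t = 0 \<and> \<gamma> * a * s + \<delta> * b * t > 0)"
      by (simp add: mult.assoc)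
  qed
qed

section \<open>From linear forms back to monomials\<close>

lemma sub_order_exists:
  assumes n: "n \<le> 2" and r: "monoid_preorder (Mon n) r"
  obtains s where "monoid_order (Mon n) s" "s \<subseteq> r"
proof -
  \<comment> \<open>Exponents of absent variables are dropped, so that \<open>n = 0, 1, 2\<close>
    are treated together.\<close>
  define mon :: "nat \<Rightarrow> nat \<Rightarrow> nat \<Rightarrow> nat" where
    "mon a b = (\<lambda>i. if i < n then (if i = 0 then a else b) else 0)" for a b
  have mon_carrier: "mon a b \<in> carrier (Mon n)" for a b
    by (auto simp: Mon_def mon_def)
  have mon_mult: "mon a b \<otimes>\<^bsub>Mon n\<^esub> mon c d = mon (a + c) (b + d)" for a b c d
    by (auto simp: Mon_def mon_def)
  have mon_eta: "mon (u 0) (u 1) = u" if "u \<in> carrier (Mon n)" for u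
  proof
    fix i
    consider "i = 0" | "i = 1" | "i \<ge> n" using n by linarith
    then show "mon (u 0) (u 1) i = u i"
      using that by cases (auto simp: Mon_def mon_def)
  qed
  define C where "C s t \<longleftrightarrow> (mon (nat (- s)) (nat (- t)), mon (nat s) (nat t)) \<in> r" for s t
  have step: "(mon a b, mon a' b') \<in> r"
    if "C s t" "int a' = int a + s" "int b' = int b + t" for a b a' b' s t
  proof -
    \<comment> \<open>The truncated subtractions are exact because \<open>a'\<close> and
      \<open>b'\<close> are nonnegative.\<close>
    have "(mon (a - nat (- s)) (b - nat (- t)) \<otimes>\<^bsub>Mon n\<^esub> mon (nat (- s)) (nat (- t)),
        mon (a - nat (- s)) (b - nat (- t)) \<otimes>\<^bsub>Mon n\<^esub> mon (nat s) (nat t)) \<in> r"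
      using that(1) unfolding C_def by (intro monoid_preorder_mult[OF r] mon_carrier)
    moreover have "a - nat (- s) + nat (- s) = a" "b - nat (- t) + nat (- t) = b"
      "a - nat (- s) + nat s = a'" "b - nat (- t) + nat t = b'"
      using that(2,3) by linarith+
    ultimately show ?thesis by (simp add: mon_mult)
  qed
  interpret sign_cone C
  proof
    show "C s t \<or> C (- s) (- t)" for s t
      using monoid_preorder_total[OF r mon_carrier mon_carrier] by (auto simp: C_def)
    show "C (s + s') (t + t')"
      if "C s t" "C s' t'" "0 \<le> s * s'" "0 \<le> t * t'" for s t s' t'
    proof -
      \<comment> \<open>The exponents after the first of the two moves; equal signs keep them
        nonnegative.\<close>
      let ?a = "nat (- (s + s')) + nat s - nat (- s)"
      let ?b = "nat (- (t + t')) + nat t - nat (- t)"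
      have "(mon (nat (- (s + s'))) (nat (- (t + t'))), mon ?a ?b) \<in> r"
        by (rule step[OF that(1)]) (use that(3,4) in \<open>auto simp: zero_le_mult_iff\<close>)
      moreover have "(mon ?a ?b, mon (nat (s + s')) (nat (t + t'))) \<in> r"
        by (rule step[OF that(2)]) (use that(3,4) in \<open>auto simp: zero_le_mult_iff\<close>)
      ultimately show ?thesis
        unfolding C_def using monoid_preorder_trans[OF r] by blast
    qed
    show "C s (t + k)" if "C s t" "C 0 k" "k * t \<le> 0" "\<bar>k\<bar> \<le> \<bar>t\<bar>" for s t k
    \<comment> \<open>The axis move comes first if \<open>t < 0\<close> and last otherwise, so that
      no exponent becomes negative on the way.\<close>
    proof (cases "t < 0")
      case True
      then have "k \<ge> 0" using that by (auto simp: mult_le_0_iff)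
      have "(mon (nat (- s)) (nat (- (t + k))), mon (nat (- s)) (nat (- t))) \<in> r"
        by (rule step[OF that(2)]) (use that True \<open>k \<ge> 0\<close> in auto)
      moreover have "(mon (nat (- s)) (nat (- t)), mon (nat s) (nat (t + k))) \<in> r"
        by (rule step[OF that(1)]) (use that True \<open>k \<ge> 0\<close> in auto)
      ultimately show ?thesis
        unfolding C_def using monoid_preorder_trans[OF r] by blast
    next
      case False
      then have "k \<le> 0" using that by (auto simp: mult_le_0_iff)
      have "(mon (nat (- s)) (nat (- (t + k))), mon (nat s) (nat t)) \<in> r"
        by (rule step[OF that(1)]) (use that False \<open>k \<le> 0\<close> in auto)
      moreover have "(mon (nat s) (nat t), mon (nat s) (nat (t + k))) \<in> r"
        by (rule step[OF that(2)]) (use that False \<open>k \<le> 0\<close> in auto)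
      ultimately show ?thesis
        unfolding C_def using monoid_preorder_trans[OF r] by blast
    qed
  qed
  obtain \<alpha> \<beta> \<gamma> \<delta> :: real where det: "\<alpha> * \<delta> - \<beta> * \<gamma> \<noteq> 0"
    and pos: "\<And>s t. \<not> C (- s) (- t) \<Longrightarrow>
      \<alpha> * s + \<beta> * t > 0 \<or> (\<alpha> * s + \<beta> * t = 0 \<and> \<gamma> * s + \<delta> * t > 0)"
    by (rule lex_weights) (rule that)
  define \<phi> where "\<phi> u = \<alpha> * real (u 0) + \<beta> * real (u 1)" for u :: "nat \<Rightarrow> nat"
  define \<psi> where "\<psi> u = \<gamma> * real (u 0) + \<delta> * real (u 1)" for u :: "nat \<Rightarrow> nat"
  define s where "s = {(u, v) \<in> carrier (Mon n) \<times> carrier (Mon n).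
    \<phi> u < \<phi> v \<or> (\<phi> u = \<phi> v \<and> \<psi> u \<le> \<psi> v)}"
  have hom: "\<phi> (w \<otimes>\<^bsub>Mon n\<^esub> u) = \<phi> w + \<phi> u" "\<psi> (w \<otimes>\<^bsub>Mon n\<^esub> u) = \<psi> w + \<psi> u" for w u
    by (simp_all add: \<phi>_def \<psi>_def Mon_def algebra_simps)
  have "monoid_preorder (Mon n) s"
    by (rule monoid_preorderI)
      (auto simp: s_def hom intro: monoid.m_closed comm_monoid_Mon[THEN comm_monoid.axioms(1)])
  moreover have "antisym s"
  proof (rule antisymI)
    fix u v assume "(u, v) \<in> s" "(v, u) \<in> s"
    then have c: "u \<in> carrier (Mon n)" "v \<in> carrier (Mon n)" and eq: "\<phi> u = \<phi> v" "\<psi> u = \<psi> v"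
      by (auto simp: s_def)
    define x y where "x = real (u 0) - real (v 0)" and "y = real (u 1) - real (v 1)"
    have "\<alpha> * x + \<beta> * y = 0" "\<gamma> * x + \<delta> * y = 0"
      using eq by (simp_all add: \<phi>_def \<psi>_def x_def y_def algebra_simps)
    then have "(\<alpha> * \<delta> - \<beta> * \<gamma>) * x = 0" "(\<alpha> * \<delta> - \<beta> * \<gamma>) * y = 0"
      by algebra+
    then have "u 0 = v 0" "u 1 = v 1" using det by (simp_all add: x_def y_def)
    then show "u = v" using mon_eta c by metis
  qed
  moreover have "s \<subseteq> r"
  proof (rule subrelI, rule ccontr)
    fix u v assume uv: "(u, v) \<in> s" "(u, v) \<notin> r"
    then have c: "u \<in> carrier (Mon n)" "v \<in> carrier (Mon n)" by (auto simp: s_def)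
    \<comment> \<open>As \<open>(u, v) \<notin> r\<close>, the difference of \<open>u\<close> and
      \<open>v\<close> is strictly positive, so the forms place \<open>u\<close> strictly above
      \<open>v\<close>.\<close>
    have "\<not> C (- (int (u 0) - int (v 0))) (- (int (u 1) - int (v 1)))"
    proof
      assume "C (- (int (u 0) - int (v 0))) (- (int (u 1) - int (v 1)))"
      then have "(mon (u 0) (u 1), mon (v 0) (v 1)) \<in> r" by (rule step) auto
      then show False using uv(2) c by (simp only: mon_eta)
    qed
    from pos[OF this] show False
      using uv(1) by (auto simp: s_def \<phi>_def \<psi>_def algebra_simps)
  qed
  ultimately show thesis
    using that by (auto simp: monoid_order_def)
qed

section \<open>A preorder in three variables containing no order\<close>

text \<open>Doubling the weight frees the odd values for the larger monomials \<open>xz\<close>,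
  \<open>yz\<close>, \<open>x^2 y\<close> of the three ties.\<close>

definition trunc_weight :: "nat \<Rightarrow> nat \<Rightarrow> nat \<Rightarrow> nat" where
  "trunc_weight a b c =
    (if 3 * a + 4 * b + 5 * c \<ge> 11 then 22
     else 2 * (3 * a + 4 * b + 5 * c) + (if (a, b, c) \<in> {(1, 0, 1), (0, 1, 1), (2, 1, 0)} then 1 else 0))"

lemma trunc_weight_le: "trunc_weight a b c \<le> 2 * (3 * a + 4 * b + 5 * c) + 1"
  by (simp add: trunc_weight_def)

lemma trunc_weight_small:
  "3 * a + 4 * b + 5 * c \<le> 7 \<Longrightarrow> trunc_weight a b c = 2 * (3 * a + 4 * b + 5 * c)"
  by (auto simp: trunc_weight_def)

text \<open>The monomials in question are 1, x, y, z, x^2, xy, of weights 0, 3, 4, 5, 6, 7.\<close>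

lemma small_weight_inj:
  fixes a b c :: nat
  assumes "3 * a + 4 * b + 5 * c = 3 * a' + 4 * b' + 5 * c'" "3 * a' + 4 * b' + 5 * c' \<le> 7"
  shows "a = a' \<and> b = b' \<and> c = c'"
proof -
  have "a \<le> 2" "b \<le> 1" "c \<le> 1" "a' \<le> 2" "b' \<le> 1" "c' \<le> 1"
    using assms by linarith+
  then show ?thesis using assms by (auto simp: le_Suc_eq numeral_2_eq_2)
qed

text \<open>A nontrivial factor weighs at least 3, so a product of weight below 11 leaves at most 7
  for the other factor, and up to there the weight determines the monomial. Hence the tie-breaks
  impose nothing on products.\<close>

lemma trunc_weight_mono:
  assumes le: "trunc_weight a b c \<le> trunc_weight a' b' c'"
  shows "trunc_weight (p + a) (q + b) (l + c) \<le> trunc_weight (p + a') (q + b') (l + c')"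
proof -
  let ?w = "\<lambda>a b c :: nat. 3 * a + 4 * b + 5 * c"
  consider "p = 0 \<and> q = 0 \<and> l = 0" | "?w (p + a') (q + b') (l + c') \<ge> 11"
    | "?w p q l \<ge> 3" "?w (p + a') (q + b') (l + c') < 11" by linarith
  then show ?thesis
  proof cases
    case 3
    then have small: "?w a' b' c' \<le> 7" by (simp add: distrib_left)
    then have "trunc_weight a b c \<le> 2 * ?w a' b' c'" using le trunc_weight_small by simp
    then have "?w a b c \<le> ?w a' b' c'"
      using small by (auto simp: trunc_weight_def split: if_splits)
    then consider "?w a b c = ?w a' b' c'" | "?w a b c < ?w a' b' c'" by linarith
    then show ?thesis
    proof cases
      case 1
      then show ?thesis using small_weight_inj[OF 1 small] by simp
    next
      case 2
      \<comment> \<open>Doubled weights differ by at least 2, more than a tie-break can add.\<close>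
      have "trunc_weight (p + a) (q + b) (l + c) \<le> 2 * ?w (p + a) (q + b) (l + c) + 1"
        by (rule trunc_weight_le)
      also have "\<dots> \<le> 2 * ?w (p + a') (q + b') (l + c')" using 2 by (simp add: distrib_left)
      also have "\<dots> \<le> trunc_weight (p + a') (q + b') (l + c')"
        using 3 by (simp add: trunc_weight_def)
      finally show ?thesis .
    qed
  qed (use le in \<open>auto simp: trunc_weight_def\<close>)
qed

lemma preorder_without_sub_order:
  assumes n: "3 \<le> n"
  obtains r where "monoid_preorder (Mon n) r"
    "\<And>s. monoid_order (Mon n) s \<Longrightarrow> \<not> s \<subseteq> r"
proof -
  \<comment> \<open>Any further variables get weight 0.\<close>
  define F where "F u = trunc_weight (u 0) (u 1) (u 2)" for u :: "nat \<Rightarrow> nat"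
  define r where "r = {(u, v) \<in> carrier (Mon n) \<times> carrier (Mon n). F u \<le> F v}"
  interpret comm_monoid "Mon n" by (rule comm_monoid_Mon)
  have "monoid_preorder (Mon n) r"
  proof (rule monoid_preorderI)
    fix u v w assume "w \<in> carrier (Mon n)" "(u, v) \<in> r"
    moreover have "F (w \<otimes>\<^bsub>Mon n\<^esub> u) \<le> F (w \<otimes>\<^bsub>Mon n\<^esub> v)" if "F u \<le> F v"
      using trunc_weight_mono that by (simp add: F_def Mon_def)
    ultimately show "(w \<otimes>\<^bsub>Mon n\<^esub> u, w \<otimes>\<^bsub>Mon n\<^esub> v) \<in> r"
      by (simp add: r_def)
  qed (auto simp: r_def)
  moreover have "\<not> s \<subseteq> r" if s: "monoid_order (Mon n) s" for s
  proof
    assume sub: "s \<subseteq> r"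
    have pre: "monoid_preorder (Mon n) s" and anti: "antisym s"
      using s by (auto simp: monoid_order_def)
    define mon :: "nat \<Rightarrow> nat \<Rightarrow> nat \<Rightarrow> nat \<Rightarrow> nat" where
      "mon a b c = (\<lambda>i. if i = 0 then a else if i = 1 then b else if i = 2 then c else 0)" for a b c
    have mon: "mon a b c \<in> carrier (Mon n)" "F (mon a b c) = trunc_weight a b c"
      "mon a b c \<otimes>\<^bsub>Mon n\<^esub> mon a' b' c' = mon (a + a') (b + b') (c + c')" for a b c a' b' c'
      using n by (auto simp: Mon_def mon_def F_def)
    have strict: "(mon a b c, mon a' b' c') \<in> s"
      if "trunc_weight a b c < trunc_weight a' b' c'" for a b c a' b' c'
      using monoid_preorder_total[OF pre mon(1) mon(1)] sub that by (fastforce simp: r_def mon(2))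
    \<comment> \<open>In the product of \<open>y^2\<close>, \<open>x^3\<close>, \<open>z^2\<close>
      the factors are replaced one at a time by \<open>xz\<close>, \<open>yz\<close>,
      \<open>x^2 y\<close>; the cofactor is the product of the other two. The last product is the
      first one again.\<close>
    have "(mon 3 0 2 \<otimes>\<^bsub>Mon n\<^esub> mon 0 2 0, mon 3 0 2 \<otimes>\<^bsub>Mon n\<^esub> mon 1 0 1) \<in> s"
      "(mon 1 0 3 \<otimes>\<^bsub>Mon n\<^esub> mon 3 0 0, mon 1 0 3 \<otimes>\<^bsub>Mon n\<^esub> mon 0 1 1) \<in> s"
      "(mon 1 1 2 \<otimes>\<^bsub>Mon n\<^esub> mon 0 0 2, mon 1 1 2 \<otimes>\<^bsub>Mon n\<^esub> mon 2 1 0) \<in> s"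
      by (intro monoid_preorder_mult[OF pre] mon strict; simp add: trunc_weight_def)+
    then have "(mon 3 2 2, mon 4 0 3) \<in> s" "(mon 4 0 3, mon 1 1 4) \<in> s" "(mon 1 1 4, mon 3 2 2) \<in> s"
      by (simp_all add: mon(3) numeral_eq_Suc)
    then have "mon 3 2 2 = mon 4 0 3"
      using monoid_preorder_trans[OF pre] antisymD[OF anti] by blast
    then have "mon 3 2 2 0 = mon 4 0 3 0" by simp
    then show False by (simp add: mon_def)
  qed
  ultimately show thesis by (rule that)
qed

theorem theorem7p1:
  fixes n :: nat
  shows "(\<forall>r. closed_point (Mon n) r \<longrightarrow> monoid_order (Mon n) r) \<longleftrightarrow> n \<le> 2"
proof
  assume all: "\<forall>r. closed_point (Mon n) r \<longrightarrow> monoid_order (Mon n) r"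
  show "n \<le> 2"
  proof (rule ccontr)
    assume "\<not> n \<le> 2"
    then obtain r where r: "monoid_preorder (Mon n) r"
      and no: "\<And>s. monoid_order (Mon n) s \<Longrightarrow> \<not> s \<subseteq> r"
      using preorder_without_sub_order[of n] by auto
    \<comment> \<open>Such an \<open>m\<close> is a closed point, hence would be an order inside
      \<open>r\<close>.\<close>
    obtain m where "monoid_preorder (Mon n) m" "m \<subseteq> r"
      "\<And>s. monoid_preorder (Mon n) s \<Longrightarrow> s \<subseteq> m \<Longrightarrow> s = m"
      using minimal_preorder_exists[OF r] by blast
    then show False
      using all no by (auto simp: closed_point_iff_minimal[OF comm_monoid_Mon])
  qed
next
  assume n: "n \<le> 2"
  show "\<forall>r. closed_point (Mon n) r \<longrightarrow> monoid_order (Mon n) r"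
  proof (intro allI impI)
    fix r assume "closed_point (Mon n) r"
    then have r: "monoid_preorder (Mon n) r"
      and min: "\<And>s. monoid_preorder (Mon n) s \<Longrightarrow> s \<subseteq> r \<Longrightarrow> s = r"
      by (auto simp: closed_point_iff_minimal[OF comm_monoid_Mon])
    obtain s where "monoid_order (Mon n) s" "s \<subseteq> r"
      by (rule sub_order_exists[OF n r])
    then show "monoid_order (Mon n) r"
      using min by (metis monoid_order_def)
  qed
qed

end
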